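(* Let $\mu\in\mathcal{P}$ be a parameter, let $\varphi_\mu^*(T)\in X$ be the corresponding optimal final time adjoint, i.e. the solution of $$(I+M\Lambda_\mu^R)\,\varphi_\mu^*(T)=M\left(e^{A_\mu T}x_\mu^0-x_\mu^T\right),$$ and let $p\in X$ be an (arbitrary) approximate final time adjoint. Then $$\|\varphi_\mu^*(T)-p\|\;\le\;\eta_\mu(p)\;\le\;\|I+M\Lambda_\mu^R\|_{\mathcal{L}(X,X)}\,\|\varphi_\mu^*(T)-p\|,$$ where $\eta_\mu(p):=\left\|M\left(e^{A_\mu T}x_\mu^0-x_\mu^T\right)-(I+M\Lambda_\mu^R)p\right\|$.
   Context: $X$ and $U$ are real Hilbert spaces (possibly infinite-dimensional), and $\mathcal{L}(V,W)$ denotes the bounded linear operators from $V$ to $W$; $I$ is the identity on $X$; norms without index are those of $X$. $T>0$ is a final time. $\mathcal{P}$ is a compact subset of a Banach space. For each $\mu\in\mathcal{P}$ we are given $A_\mu\in\mathcal{L}(X,X)$, $B_\mu\in\mathcal{L}(U,X)$, an initial state $x_\mu^0\in X$ and a target state $x_\mu^T\in X$; the four maps $\mu\mapsto A_\mu,\ B_\mu,\ x_\mu^0,\ x_\mu^T$ are Lipschitz continuous on $\mathcal{P}$. $M\in\mathcal{L}(X,X)$ is self-adjoint and positive-semidefinite; $R\in\mathcal{L}(U,U)$ is self-adjoint with $R\ge\alpha I$ for some $\alpha>0$. $A^*$ denotes the Hilbert space adjoint. The weighted controllability Gramian is $$\Lambda_\mu^R:=\int_0^T e^{A_\mu(T-s)}B_\mu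 R^{-1}B_\mu^*e^{A_\mu^*(T-s)}\,ds\in\mathcal{L}(X,X).$$ Standing assumption: for all $\mu\in\mathcal{P}$ the operator $M\Lambda_\mu^R$ is positive-semidefinite, i.e. $\langle M\Lambda_\mu^R p,p\rangle\ge 0$ for all $p\in X$. The optimal final time adjoint $\varphi_\mu^*(T)$ is the value at time $T$ of the adjoint state of the optimality system $\dot x=A_\mu x+B_\mu u$, $-\dot\varphi=A_\mu^*\varphi$, $u=-R^{-1}B_\mu^*\varphi$ on $[0,T]$, $x(0)=x_\mu^0$, $\varphi(T)=M(x(T)-x_\mu^T)$; it is characterized by the linear equation displayed in the claim. *)

theory Defs
  imports "HOL-Analysis.Analysis"
begin

text \<open>
  A real Hilbert space is a type of sort \<open>{real_inner, banach}\<close>; it may be infinite-dimensional.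
  A bounded linear operator is an element of \<open>'a \<Rightarrow>\<^sub>L 'b\<close>, whose norm is the operator norm.
\<close>

section \<open>Adjoint\<close>

text \<open>\<open>adjoint\<close> is a Hilbert choice in the library, where it is only shown to exist for
  finite-dimensional domains. Below, existence and boundedness are shown on Hilbert spaces.\<close>

definition op_adjoint ::
  "('a::{real_inner, banach} \<Rightarrow>\<^sub>L 'b::{real_inner, banach}) \<Rightarrow> 'b \<Rightarrow>\<^sub>L 'a" where
  "op_adjoint A = Blinfun (adjoint (blinfun_apply A))"

lemma riesz_representation:
  fixes f :: "'a::{real_inner, banach} \<Rightarrow> real"
  assumes "bounded_linear f"
  obtains z where "\<And>x. f x = z \<bullet> x"
proof -
  interpret f: bounded_linear f by fact
  obtain K where K: "\<And>x. \<bar>f x\<bar> \<le> norm x * K"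
    using f.bounded by (auto simp: real_norm_def)
  define J where "J x = x \<bullet> x - 2 * f x" for x
  have J_lower: "- (K\<^sup>2) \<le> J x" for x
  proof -
    have "0 \<le> (norm x - K)\<^sup>2" by simp
    moreover have "2 * f x \<le> 2 * (norm x * K)" using K[of x] by linarith
    ultimately show ?thesis
      by (simp add: J_def dot_square_norm power2_diff algebra_simps)
  qed
  define m where "m = (INF x. J x)"
  have m_le: "m \<le> J x" for x
    unfolding m_def by (rule cINF_lower) (auto intro!: bdd_belowI2 J_lower)
  have "\<exists>x. J x < m + inverse (real (Suc n))" for n
  proof (rule ccontr)
    assume "\<nexists>x. J x < m + inverse (real (Suc n))"
    then have "m + inverse (real (Suc n)) \<le> (INF x. J x)"
      by (intro cINF_greatest) (auto simp: not_less)
    moreover have "0 < inverse (real (Suc n))" by simp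
    ultimately show False unfolding m_def by linarith
  qed
  then obtain X where X: "\<And>n. J (X n) < m + inverse (real (Suc n))" by metis
  have par: "J x + J y = 2 * J ((1/2) *\<^sub>R (x + y)) + (norm (x - y))\<^sup>2 / 2" for x y
  proof -
    have "y \<bullet> x = x \<bullet> y" by (rule inner_commute)
    then show ?thesis
      unfolding J_def f.scaleR f.add power2_norm_eq_inner
      by (simp add: inner_add_left inner_add_right inner_diff_left inner_diff_right
          add_divide_distrib diff_divide_distrib algebra_simps)
  qed
  have dist_X: "(norm (X k - X l))\<^sup>2 < 2 * (inverse (real (Suc k)) + inverse (real (Suc l)))" for k l
  proof -
    have "c < 2 * (a + b)"
      if "u + v = 2 * w + c / 2" "u < m + a" "v < m + b" "m \<le> w" for a b c u v w :: real
    proof -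
      have "u + v < 2 * m + (a + b)" "2 * m \<le> 2 * w" using that by auto
      then have "c / 2 < a + b" using that(1) by simp
      then show ?thesis by simp
    qed
    then show ?thesis
      using par[of "X k" "X l"] X[of k] X[of l] m_le[of "(1/2) *\<^sub>R (X k + X l)"] by blast
  qed
  have "Cauchy X"
  proof (rule metric_CauchyI)
    fix e :: real assume "0 < e"
    then have "0 < e\<^sup>2 / 4" by simp
    then obtain N where N: "inverse (real (Suc N)) < e\<^sup>2 / 4"
      using reals_Archimedean by blast
    have "dist (X k) (X l) < e" if "k \<ge> N" "l \<ge> N" for k l
    proof -
      have "inverse (real (Suc j)) \<le> inverse (real (Suc N))" if "j \<ge> N" for j
        using that by (intro le_imp_inverse_le) auto
      note le = this[OF that(1)] this[OF that(2)]
      have "(norm (X k - X l))\<^sup>2 < 2 * (inverse (real (Suc k)) + inverse (real (Suc l)))"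
        by (rule dist_X)
      also have "\<dots> \<le> 2 * (inverse (real (Suc N)) + inverse (real (Suc N)))"
        by (intro mult_left_mono add_mono le) simp
      also have "\<dots> = 4 * inverse (real (Suc N))" by simp
      also have "\<dots> < 4 * (e\<^sup>2 / 4)" by (rule mult_strict_left_mono[OF N]) simp
      also have "\<dots> = e\<^sup>2" by simp
      finally have "(norm (X k - X l))\<^sup>2 < e\<^sup>2" .
      then show ?thesis
        unfolding dist_norm by (rule power2_less_imp_less) (use \<open>0 < e\<close> in simp)
    qed
    then show "\<exists>N. \<forall>k\<ge>N. \<forall>l\<ge>N. dist (X k) (X l) < e" by blast
  qed
  then obtain z where z: "X \<longlonglongrightarrow> z"
    using Cauchy_convergent convergent_def by blast
  have "(\<lambda>n. J (X n)) \<longlonglongrightarrow> J z"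
    unfolding J_def by (intro tendsto_intros z f.tendsto)
  moreover have "(\<lambda>n. m + inverse (real (Suc n))) \<longlonglongrightarrow> m + 0"
    by (intro tendsto_add tendsto_const LIMSEQ_inverse_real_of_nat)
  ultimately have "J z \<le> m + 0"
    by (rule LIMSEQ_le) (use X less_imp_le in blast)
  then have z_min: "J z \<le> J x" for x using m_le[of x] by simp
  have "f y = z \<bullet> y" for y
  proof (cases "y = 0")
    case False
    define d where "d = z \<bullet> y - f y"
    define t where "t = - d / (y \<bullet> y)"
    have yy: "0 < y \<bullet> y" using False by simp
    have "J (z + t *\<^sub>R y) = J z + 2 * t * d + t\<^sup>2 * (y \<bullet> y)"
      unfolding J_def d_def f.add f.scaleR
      by (simp add: inner_add inner_commute algebra_simps power2_eq_square)
    also have "\<dots> = J z - d\<^sup>2 / (y \<bullet> y)"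
      using yy by (simp add: t_def power2_eq_square field_simps)
    finally have "d\<^sup>2 / (y \<bullet> y) \<le> 0" using z_min[of "z + t *\<^sub>R y"] by linarith
    then have "d\<^sup>2 \<le> 0" using yy by (simp add: divide_le_0_iff)
    then show ?thesis by (simp add: d_def)
  qed (simp add: f.zero)
  then show thesis by (rule that)
qed

lemma inner_adjoint:
  fixes A :: "'a::{real_inner, banach} \<Rightarrow>\<^sub>L 'b::{real_inner, banach}"
  shows "A x \<bullet> y = x \<bullet> adjoint (blinfun_apply A) y"
proof -
  have "\<exists>z. \<forall>x. A x \<bullet> y = x \<bullet> z" for y
  proof -
    have "bounded_linear (\<lambda>x. A x \<bullet> y)"
      by (intro bounded_linear_intros)
    then obtain z where "\<And>x. A x \<bullet> y = z \<bullet> x" using riesz_representation by blast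
    then show ?thesis by (metis inner_commute)
  qed
  then obtain g where "\<forall>x y. A x \<bullet> y = x \<bullet> g y" by metis
  then show ?thesis using adjoint_unique by metis
qed

lemma bounded_linear_adjoint:
  fixes A :: "'a::{real_inner, banach} \<Rightarrow>\<^sub>L 'b::{real_inner, banach}"
  shows "bounded_linear (adjoint (blinfun_apply A))"
proof (rule bounded_linear_intro)
  let ?g = "adjoint (blinfun_apply A)"
  show "?g (x + y) = ?g x + ?g y" for x y
  proof (rule vector_eq_ldot[THEN iffD1], rule allI)
    show "z \<bullet> ?g (x + y) = z \<bullet> (?g x + ?g y)" for z
      by (simp only: inner_add_right inner_adjoint[symmetric])
  qed
  show "?g (r *\<^sub>R x) = r *\<^sub>R ?g x" for r x
  proof (rule vector_eq_ldot[THEN iffD1], rule allI)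
    show "z \<bullet> ?g (r *\<^sub>R x) = z \<bullet> (r *\<^sub>R ?g x)" for z
      by (simp only: inner_scaleR_right inner_adjoint[symmetric])
  qed
  show "norm (?g y) \<le> norm y * norm A" for y
  proof -
    have "norm (?g y) * norm (?g y) = A (?g y) \<bullet> y"
      by (simp add: inner_adjoint dot_square_norm power2_eq_square)
    also have "\<dots> \<le> norm (A (?g y)) * norm y" by (rule norm_cauchy_schwarz)
    also have "\<dots> \<le> norm A * norm (?g y) * norm y"
      by (intro mult_right_mono norm_blinfun norm_ge_zero)
    finally have "norm (?g y) * norm (?g y) \<le> norm (?g y) * (norm y * norm A)"
      by (simp add: mult_ac)
    then show ?thesis
      by (cases "norm (?g y) = 0") (auto simp: mult_le_cancel_left_pos)
  qed
qed

lemma inner_op_adjoint: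
  fixes A :: "'a::{real_inner, banach} \<Rightarrow>\<^sub>L 'b::{real_inner, banach}"
  shows "A x \<bullet> y = x \<bullet> op_adjoint A y"
  by (simp add: op_adjoint_def bounded_linear_Blinfun_apply bounded_linear_adjoint
      flip: inner_adjoint)

section \<open>Self-adjointness, positivity and coercivity\<close>

definition self_adjoint :: "('a::{real_inner, banach} \<Rightarrow>\<^sub>L 'a) \<Rightarrow> bool" where
  "self_adjoint A \<longleftrightarrow> op_adjoint A = A"

text \<open>Self-adjointness is not part of this notion: the product of two positive-semidefinite
  self-adjoint operators need not be self-adjoint.\<close>

definition positive_semidefinite :: "('a::{real_inner, banach} \<Rightarrow>\<^sub>L 'a) \<Rightarrow> bool" where
  "positive_semidefinite A \<longleftrightarrow> (\<forall>p. 0 \<le> A p \<bullet> p)"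

definition op_ge :: "('a::{real_inner, banach} \<Rightarrow>\<^sub>L 'a) \<Rightarrow> ('a \<Rightarrow>\<^sub>L 'a) \<Rightarrow> bool" where
  "op_ge A B \<longleftrightarrow> positive_semidefinite (A - B)"

section \<open>Inverse\<close>

text \<open>Only meaningful if \<open>A\<close> is bijective with bounded inverse. Every coercive operator is, by the
  Lax--Milgram argument below.\<close>

definition op_inverse :: "('a::real_normed_vector \<Rightarrow>\<^sub>L 'b::real_normed_vector) \<Rightarrow> 'b \<Rightarrow>\<^sub>L 'a" where
  "op_inverse A = Blinfun (inv (blinfun_apply A))"

lemma coercive_norm_le:
  fixes A :: "'a::{real_inner, banach} \<Rightarrow>\<^sub>L 'a"
  assumes "op_ge A (\<alpha> *\<^sub>R id_blinfun)"
  shows "\<alpha> * norm x \<le> norm (A x)"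
proof (cases "x = 0")
  case False
  have "\<alpha> * norm x * norm x \<le> A x \<bullet> x"
    using assms
    by (simp add: op_ge_def positive_semidefinite_def blinfun.bilinear_simps inner_diff_left
        dot_square_norm power2_eq_square mult.assoc)
  also have "\<dots> \<le> norm (A x) * norm x" by (rule norm_cauchy_schwarz)
  finally show ?thesis using False by simp
qed simp

lemma coercive_bij:
  fixes A :: "'a::{real_inner, banach} \<Rightarrow>\<^sub>L 'a"
  assumes "op_ge A (\<alpha> *\<^sub>R id_blinfun)" "0 < \<alpha>"
  shows "bij (blinfun_apply A)"
proof (rule bijI)
  show "inj (blinfun_apply A)"
  proof (rule injI)
    fix x y assume "A x = A y"
    then have "A (x - y) = 0" by (simp add: blinfun.diff_right)
    then have "\<alpha> * norm (x - y) \<le> 0" using coercive_norm_le[OF assms(1), of "x - y"] by simp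
    then show "x = y" using \<open>0 < \<alpha>\<close> by (simp add: mult_le_0_iff)
  qed
next
  define C where "C = max (norm A) \<alpha>"
  define r where "r = \<alpha> / C\<^sup>2"
  define c where "c = 1 - \<alpha>\<^sup>2 / C\<^sup>2"
  have C: "0 < C" "\<alpha> \<le> C" "norm A \<le> C" using \<open>0 < \<alpha>\<close> by (auto simp: C_def)
  have c: "0 \<le> c" "c < 1"
    using C \<open>0 < \<alpha>\<close> by (auto simp: c_def divide_le_eq_1 power_mono)
  have r: "0 < r" using C \<open>0 < \<alpha>\<close> by (simp add: r_def)
  have contr: "norm (x - r *\<^sub>R A x) \<le> sqrt c * norm x" for x
  proof -
    have co: "\<alpha> * (norm x)\<^sup>2 \<le> A x \<bullet> x"
      using assms(1)
      by (simp add: op_ge_def positive_semidefinite_def blinfun.bilinear_simps inner_diff_left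
          dot_square_norm)
    have "norm (A x) \<le> C * norm x"
      using norm_blinfun[of A x] C(3) by (meson mult_right_mono norm_ge_zero order_trans)
    then have bd: "(norm (A x))\<^sup>2 \<le> C\<^sup>2 * (norm x)\<^sup>2"
      by (metis norm_ge_zero power_mono power_mult_distrib)
    have "(norm (x - r *\<^sub>R A x))\<^sup>2 = (norm x)\<^sup>2 - 2 * r * (A x \<bullet> x) + r\<^sup>2 * (norm (A x))\<^sup>2"
    proof -
      have "x \<bullet> A x = A x \<bullet> x" by (rule inner_commute)
      then show ?thesis
        unfolding power2_norm_eq_inner
        unfolding inner_diff_left inner_diff_right inner_scaleR_left inner_scaleR_right
          power2_eq_square \<open>x \<bullet> A x = A x \<bullet> x\<close>
        by (simp only: ring_distribs mult_2 mult.assoc)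
    qed
    also have "\<dots> \<le> (norm x)\<^sup>2 - 2 * r * (\<alpha> * (norm x)\<^sup>2) + r\<^sup>2 * (C\<^sup>2 * (norm x)\<^sup>2)"
      using r by (intro add_mono diff_mono mult_left_mono co bd) auto
    also have "\<dots> = c * (norm x)\<^sup>2"
    proof -
      have "r * \<alpha> = \<alpha>\<^sup>2 / C\<^sup>2" by (simp add: r_def power2_eq_square)
      moreover have "r\<^sup>2 * C\<^sup>2 = \<alpha>\<^sup>2 / C\<^sup>2"
        using C by (simp add: r_def power_divide power2_eq_square)
      moreover have "n - 2 * r * (\<alpha> * n) + r\<^sup>2 * (C\<^sup>2 * n) = n - 2 * (r * \<alpha>) * n + r\<^sup>2 * C\<^sup>2 * n"
        for n :: real by (simp only: mult.assoc)
      moreover have "n - 2 * q * n + q * n = (1 - q) * n" for q n :: real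
        by (simp only: left_diff_distrib)
      ultimately show ?thesis by (simp only: c_def)
    qed
    also have "\<dots> = (sqrt c * norm x)\<^sup>2" using c by (simp add: power_mult_distrib)
    finally show ?thesis by (rule power2_le_imp_le) (use c in simp)
  qed
  show "surj (blinfun_apply A)"
    unfolding surj_def
  proof
    fix y
    have "\<exists>!x. x - r *\<^sub>R (A x - y) = x"
    proof (rule banach_fix_type[of "sqrt c"])
      show "0 \<le> sqrt c" "sqrt c < 1" using c by auto
      show "\<forall>x z. dist (x - r *\<^sub>R (A x - y)) (z - r *\<^sub>R (A z - y)) \<le> sqrt c * dist x z"
      proof (intro allI)
        fix x z
        have "(x - r *\<^sub>R (A x - y)) - (z - r *\<^sub>R (A z - y)) = (x - z) - r *\<^sub>R A (x - z)"
          by (simp add: blinfun.diff_right scaleR_diff_right)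
        then show "dist (x - r *\<^sub>R (A x - y)) (z - r *\<^sub>R (A z - y)) \<le> sqrt c * dist x z"
          unfolding dist_norm by (simp only: contr)
      qed
    qed
    then obtain x where "x - r *\<^sub>R (A x - y) = x" by blast
    then show "\<exists>x. y = A x" using r by auto
  qed
qed

lemma op_inverse_coercive:
  fixes A :: "'a::{real_inner, banach} \<Rightarrow>\<^sub>L 'a"
  assumes "op_ge A (\<alpha> *\<^sub>R id_blinfun)" "0 < \<alpha>"
  shows "op_inverse A o\<^sub>L A = id_blinfun" "A o\<^sub>L op_inverse A = id_blinfun"
proof -
  note bij = coercive_bij[OF assms]
  have Ainv: "A (inv (blinfun_apply A) y) = y" for y
    using bij by (simp add: bij_is_surj surj_f_inv_f)
  have invA: "inv (blinfun_apply A) (A x) = x" for x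
    using bij by (simp add: bij_is_inj inv_f_f)
  have "bounded_linear (inv (blinfun_apply A))"
  proof (rule bounded_linear_intro)
    show "inv (blinfun_apply A) (x + y) = inv (blinfun_apply A) x + inv (blinfun_apply A) y" for x y
      using invA[of "inv (blinfun_apply A) x + inv (blinfun_apply A) y"]
      by (simp only: blinfun.add_right Ainv)
    show "inv (blinfun_apply A) (r *\<^sub>R x) = r *\<^sub>R inv (blinfun_apply A) x" for r x
      using invA[of "r *\<^sub>R inv (blinfun_apply A) x"]
      by (simp only: blinfun.scaleR_right Ainv)
    show "norm (inv (blinfun_apply A) x) \<le> norm x * (1 / \<alpha>)" for x
      using coercive_norm_le[OF assms(1), of "inv (blinfun_apply A) x"] \<open>0 < \<alpha>\<close>
      by (simp add: Ainv field_simps)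
  qed
  then have "blinfun_apply (op_inverse A) = inv (blinfun_apply A)"
    by (simp add: op_inverse_def bounded_linear_Blinfun_apply)
  then show "op_inverse A o\<^sub>L A = id_blinfun" "A o\<^sub>L op_inverse A = id_blinfun"
    by (auto intro!: blinfun_eqI simp: Ainv invA)
qed

section \<open>Operator exponential\<close>

text \<open>\<open>exp\<close> from the library is not available, since \<open>'a \<Rightarrow>\<^sub>L 'a\<close> is not an instance of
  \<open>real_normed_algebra_1\<close>.\<close>

definition op_power :: "('a::real_normed_vector \<Rightarrow>\<^sub>L 'a) \<Rightarrow> nat \<Rightarrow> 'a \<Rightarrow>\<^sub>L 'a" where
  "op_power A n = ((o\<^sub>L) A ^^ n) id_blinfun"

definition op_exp :: "('a::banach \<Rightarrow>\<^sub>L 'a) \<Rightarrow> 'a \<Rightarrow>\<^sub>L 'a" where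
  "op_exp A = (\<Sum>n. op_power A n /\<^sub>R fact n)"

lemma norm_op_power_le: "norm (op_power A n) \<le> norm A ^ n"
proof (induction n)
  case 0
  then show ?case by (simp add: op_power_def norm_blinfun_id_le)
next
  case (Suc n)
  have "norm (op_power A (Suc n)) \<le> norm A * norm (op_power A n)"
    by (simp add: op_power_def norm_blinfun_compose)
  also have "\<dots> \<le> norm A * norm A ^ n"
    by (intro mult_left_mono Suc.IH norm_ge_zero)
  finally show ?case by simp
qed

lemma op_power_scaleR: "op_power (t *\<^sub>R A) n = t ^ n *\<^sub>R op_power A n"
  by (induction n)
     (simp_all add: op_power_def bounded_bilinear.scaleR_left[OF bounded_bilinear_blinfun_compose]
       bounded_bilinear.scaleR_right[OF bounded_bilinear_blinfun_compose])

lemma norm_op_exp_term_le: "norm (op_power A n /\<^sub>R fact n) \<le> norm A ^ n /\<^sub>R fact n"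
  by (simp add: norm_op_power_le mult_left_mono)

lemma sums_op_exp: "(\<lambda>n. op_power A n /\<^sub>R fact n) sums op_exp A"
  unfolding op_exp_def
  by (rule summable_sums, rule summable_comparison_test'[OF summable_exp_generic[of "norm A"]])
     (rule norm_op_exp_term_le)

lemma continuous_on_op_exp: "continuous_on {-a..a} (\<lambda>t. op_exp (t *\<^sub>R A))"
proof -
  have "uniform_limit {-a..a} (\<lambda>n t. \<Sum>i<n. op_power (t *\<^sub>R A) i /\<^sub>R fact i)
          (\<lambda>t. op_exp (t *\<^sub>R A)) sequentially"
    unfolding op_exp_def
  proof (rule Weierstrass_m_test)
    show "summable (\<lambda>n. (a * norm A) ^ n /\<^sub>R fact n)" by (rule summable_exp_generic)
    fix n t assume "t \<in> {-a..a}"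
    then have "norm (t *\<^sub>R A) \<le> a * norm A" by (auto intro!: mult_right_mono)
    then have "norm (t *\<^sub>R A) ^ n /\<^sub>R fact n \<le> (a * norm A) ^ n /\<^sub>R fact n"
      by (intro scaleR_left_mono power_mono) auto
    then show "norm (op_power (t *\<^sub>R A) n /\<^sub>R fact n) \<le> (a * norm A) ^ n /\<^sub>R fact n"
      using norm_op_exp_term_le order_trans by blast
  qed
  then show ?thesis
    by (rule uniform_limit_theorem[rotated])
       (auto simp: op_power_scaleR intro!: always_eventually continuous_intros)
qed

section \<open>Weighted controllability Gramian and error estimator\<close>

text \<open>The integrand is norm-continuous, so the integral of operator-valued functions exists.\<close>

definition weighted_gramian ::
  "real \<Rightarrow> ('x::{real_inner, banach} \<Rightarrow>\<^sub>L 'x) \<Rightarrow> ('u::{real_inner, banach} \<Rightarrow>\<^sub>L 'x) \<Rightarrow> ('u \<Rightarrow>\<^sub>L 'u)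
    \<Rightarrow> 'x \<Rightarrow>\<^sub>L 'x" where
  "weighted_gramian T A B R =
     integral {0..T} (\<lambda>s. op_exp ((T - s) *\<^sub>R A) o\<^sub>L B o\<^sub>L op_inverse R o\<^sub>L op_adjoint B
                            o\<^sub>L op_exp ((T - s) *\<^sub>R op_adjoint A))"

lemma weighted_gramian_integrable:
  "(\<lambda>s. op_exp ((T - s) *\<^sub>R A) o\<^sub>L B o\<^sub>L op_inverse R o\<^sub>L op_adjoint B
          o\<^sub>L op_exp ((T - s) *\<^sub>R op_adjoint A)) integrable_on {0..T}"
proof (rule integrable_continuous_real)
  have "continuous_on {0..T} (\<lambda>s. op_exp ((T - s) *\<^sub>R A))" for A :: "'x::banach \<Rightarrow>\<^sub>L 'x"
    by (rule continuous_on_compose2[OF continuous_on_op_exp[of T A], of _ "\<lambda>s. T - s"])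
       (auto intro!: continuous_intros)
  then show "continuous_on {0..T} (\<lambda>s. op_exp ((T - s) *\<^sub>R A) o\<^sub>L B o\<^sub>L op_inverse R
      o\<^sub>L op_adjoint B o\<^sub>L op_exp ((T - s) *\<^sub>R op_adjoint A))"
    by (intro bounded_bilinear.continuous_on[OF bounded_bilinear_blinfun_compose]
        continuous_on_const)
qed

definition error_estimator ::
  "real \<Rightarrow> ('x::{real_inner, banach} \<Rightarrow>\<^sub>L 'x) \<Rightarrow> ('u::{real_inner, banach} \<Rightarrow>\<^sub>L 'x) \<Rightarrow> 'x \<Rightarrow> 'x
    \<Rightarrow> ('x \<Rightarrow>\<^sub>L 'x) \<Rightarrow> ('u \<Rightarrow>\<^sub>L 'u) \<Rightarrow> 'x \<Rightarrow> real" where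
  "error_estimator T A B x0 xT M R p =
     norm (M (op_exp (T *\<^sub>R A) x0 - xT) - (id_blinfun + (M o\<^sub>L weighted_gramian T A B R)) p)"

text \<open>Solutions of the equation \<open>(I + M \<Lambda>) \<phi> = b\<close> exist and are unique.\<close>

lemma final_adjoint_equation_ex1:
  fixes L :: "'x::{real_inner, banach} \<Rightarrow>\<^sub>L 'x"
  assumes "positive_semidefinite (M o\<^sub>L L)"
  shows "\<exists>!\<phi>. (id_blinfun + (M o\<^sub>L L)) \<phi> = b"
proof -
  have "bij (blinfun_apply (id_blinfun + (M o\<^sub>L L)))"
    using assms by (intro coercive_bij[of _ 1]) (simp_all add: op_ge_def)
  then show ?thesis by (simp add: bij_iff)
qed

end

theory Submission
  imports Defs
begin

text \<open>
  The estimator is the norm of a residual: since \<open>\<phi>\<close> solves the optimality equation, inserting it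
  for the right-hand side turns \<open>M (e\<^sup>T\<^sup>A x0 - xT) - (I + M \<Lambda>) p\<close> into \<open>(I + M \<Lambda>) (\<phi> - p)\<close>. The
  upper estimate is the definition of the operator norm. The lower one expresses that
  \<open>I + M \<Lambda>\<close> does not shrink vectors: positive semidefiniteness of \<open>M \<Lambda>\<close> gives
  \<open>\<parallel>v\<parallel>\<^sup>2 \<le> \<langle>(I + M \<Lambda>) v, v\<rangle> \<le> \<parallel>(I + M \<Lambda>) v\<parallel> \<parallel>v\<parallel>\<close>.
\<close>

text \<open>Adding a positive-semidefinite operator to the identity gives an operator that is coercive
  with constant \<open>1\<close>; this constant is why no stability factor enters the error bound.\<close>

lemma norm_le_norm_id_plus_positive_semidefinite:
  fixes P :: "'a::{real_inner, banach} \<Rightarrow>\<^sub>L 'a"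
  assumes "positive_semidefinite P"
  shows "norm v \<le> norm ((id_blinfun + P) v)"
proof -
  have "op_ge (id_blinfun + P) (1 *\<^sub>R id_blinfun)"
    using assms by (simp add: op_ge_def)
  from coercive_norm_le[OF this, of v] show ?thesis by simp
qed

lemma error_estimator_eq_norm_residual:
  assumes "(id_blinfun + (M o\<^sub>L weighted_gramian T A B R)) \<phi> = M (op_exp (T *\<^sub>R A) x0 - xT)"
  shows "error_estimator T A B x0 xT M R p
    = norm ((id_blinfun + (M o\<^sub>L weighted_gramian T A B R)) (\<phi> - p))"
  unfolding error_estimator_def assms[symmetric] by (simp only: blinfun.diff_right)

theorem theorem2:
  fixes \<P> :: "'p::banach set"
    and T \<alpha> :: real
    and A :: "'p \<Rightarrow> 'x::{real_inner, banach} \<Rightarrow>\<^sub>L 'x"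
    and B :: "'p \<Rightarrow> 'u::{real_inner, banach} \<Rightarrow>\<^sub>L 'x"
    and x0 xT :: "'p \<Rightarrow> 'x"
    and M :: "'x \<Rightarrow>\<^sub>L 'x"
    and R :: "'u \<Rightarrow>\<^sub>L 'u"
    and \<mu> :: 'p
    and \<phi> p :: 'x
  assumes "0 < T"
    and "compact \<P>"
    and "\<exists>L. L-lipschitz_on \<P> A"
    and "\<exists>L. L-lipschitz_on \<P> B"
    and "\<exists>L. L-lipschitz_on \<P> x0"
    and "\<exists>L. L-lipschitz_on \<P> xT"
    and "self_adjoint M"
    and "positive_semidefinite M"
    and "self_adjoint R"
    and "0 < \<alpha>"
    and "op_ge R (\<alpha> *\<^sub>R id_blinfun)"
    and "\<forall>\<nu>\<in>\<P>. positive_semidefinite (M o\<^sub>L weighted_gramian T (A \<nu>) (B \<nu>) R)"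
    and "\<mu> \<in> \<P>"
    and "(id_blinfun + (M o\<^sub>L weighted_gramian T (A \<mu>) (B \<mu>) R)) \<phi>
           = M (op_exp (T *\<^sub>R A \<mu>) (x0 \<mu>) - xT \<mu>)"
  shows "norm (\<phi> - p) \<le> error_estimator T (A \<mu>) (B \<mu>) (x0 \<mu>) (xT \<mu>) M R p
    \<and> error_estimator T (A \<mu>) (B \<mu>) (x0 \<mu>) (xT \<mu>) M R p
        \<le> norm (id_blinfun + (M o\<^sub>L weighted_gramian T (A \<mu>) (B \<mu>) R)) * norm (\<phi> - p)"
proof -
  let ?P = "M o\<^sub>L weighted_gramian T (A \<mu>) (B \<mu>) R"
  have "positive_semidefinite ?P"
    using assms(12,13) by blast
  then have "norm (\<phi> - p) \<le> norm ((id_blinfun + ?P) (\<phi> - p))"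
    by (rule norm_le_norm_id_plus_positive_semidefinite)
  moreover have "norm ((id_blinfun + ?P) (\<phi> - p)) \<le> norm (id_blinfun + ?P) * norm (\<phi> - p)"
    by (rule norm_blinfun)
  ultimately show ?thesis
    unfolding error_estimator_eq_norm_residual[OF assms(14)] by blast
qed

end
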